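(* Let $p$ be a prime, $n\ge 1$, $q=p^n$, and let $\gamma\in\mathbb{F}_q^*$ have multiplicative order $T$; put $G=\langle\gamma\rangle$. Let $(\beta_1,\ldots,\beta_n)$ be an ordered basis of $\mathbb{F}_q$ over $\mathbb{F}_p$ and let $P:G\to\mathbb{F}_q$ be the map $P(\gamma^x)=\xi_x$ for $x=0,1,\ldots,T-1$. Let $m$ be an integer with $0\le m\le T$ and $F:\mathbb{F}_q\to\mathbb{F}_q$ a map with $F(\zeta)=P(\zeta)$ for all but at most $m$ elements $\zeta\in G$. Suppose there exist an $\mathbb{F}_p$-linear subspace $U\le\mathbb{F}_q$ of codimension $k$, a linearised polynomial $M\in\mathbb{F}_q[X]$ and constants $a_V\in\mathbb{F}_q$ indexed by the cosets $V$ of $U$, such that $F(\zeta)=M(\zeta)+a_{U+\zeta}$ for all $\zeta\in\mathbb{F}_q$. If $\gcd(T,p-1)>1$, then $p^k\ge \frac{T-2m}{2^n}$.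
   Context: A linearised polynomial over $\mathbb{F}_q$ is one of the form $\sum_{j=0}^{n-1}c_jX^{p^j}$, $c_j\in\mathbb{F}_q$. For an integer $0\le x\le q-1$ with base-$p$ expansion $x=x_1+x_2p+\cdots+x_np^{n-1}$, $0\le x_i<p$, one sets $\xi_x=x_1\beta_1+\cdots+x_n\beta_n\in\mathbb{F}_q$. *)

theory Defs
  imports Complex_Main "Berlekamp_Zassenhaus.Finite_Field"
begin

text \<open>
  The type \<open>'a ring_char\<close> has \<open>CHAR('a)\<close> elements, so for a field \<open>'a\<close> of characteristic \<open>p > 0\<close>
  the type \<open>'a ring_char mod_ring\<close> is the field of integers modulo \<open>p\<close>. It acts on \<open>'a\<close> via the
  representatives \<open>0, \<dots>, p - 1\<close>.
\<close>

definition Fp_scale :: "'a ring_char mod_ring \<Rightarrow> 'a \<Rightarrow> 'a::field_prime_char" where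
  "Fp_scale c x = of_int (to_int_mod_ring c) * x"

global_interpretation Fp: vector_space "Fp_scale :: _ \<Rightarrow> 'a \<Rightarrow> 'a::field_prime_char"
proof
  fix a b :: "'a ring_char mod_ring" and x y :: 'a
  show "Fp_scale a (x + y) = Fp_scale a x + Fp_scale a y"
    by (simp add: Fp_scale_def algebra_simps)
  show "Fp_scale (a + b) x = Fp_scale a x + Fp_scale b x"
    by (simp add: Fp_scale_def to_int_mod_ring_add algebra_simps)
  show "Fp_scale a (Fp_scale b x) = Fp_scale (a * b) x"
    by (simp add: Fp_scale_def to_int_mod_ring_mult algebra_simps)
  show "Fp_scale 1 x = x"
    by (simp add: Fp_scale_def)
qed

definition ordered_Fp_basis :: "nat \<Rightarrow> (nat \<Rightarrow> 'a::finite_field) \<Rightarrow> bool" where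
  "ordered_Fp_basis n \<beta> \<longleftrightarrow>
     inj_on \<beta> {1..n} \<and> Fp.independent (\<beta> ` {1..n}) \<and> Fp.span (\<beta> ` {1..n}) = UNIV"

definition Fp_codim :: "'a::finite_field set \<Rightarrow> nat" where
  "Fp_codim U = Fp.dim (UNIV :: 'a set) - Fp.dim U"

definition coset :: "'a::ab_group_add set \<Rightarrow> 'a \<Rightarrow> 'a set" where
  "coset U z = (\<lambda>u. u + z) ` U"

definition mult_order :: "'a::field \<Rightarrow> nat" where
  "mult_order g = (LEAST t. 0 < t \<and> g ^ t = 1)"

definition cyclic_subgroup :: "'a::field \<Rightarrow> 'a set" where
  "cyclic_subgroup g = range (\<lambda>i::int. g powi i)"

text \<open>The \<open>i\<close>-th base-\<open>p\<close> digit, counted from \<open>1\<close>, is \<open>x div p ^ (i - 1) mod p\<close>.\<close>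

definition xi :: "nat \<Rightarrow> nat \<Rightarrow> (nat \<Rightarrow> 'a::field) \<Rightarrow> nat \<Rightarrow> 'a" where
  "xi p n \<beta> x = (\<Sum>i = 1..n. of_nat (x div p ^ (i - 1) mod p) * \<beta> i)"

definition linearised_poly :: "nat \<Rightarrow> nat \<Rightarrow> 'a::field poly \<Rightarrow> bool" where
  "linearised_poly p n M \<longleftrightarrow> (\<exists>c. M = (\<Sum>j<n. monom (c j) (p ^ j)))"

end

theory Submission
  imports Defs
begin

text \<open>
  If \<open>gcd(T, p - 1) > 1\<close>, the group \<open>G\<close> contains some \<open>\<lambda> \<in> \<bbbF>\<^sub>p\<close> with \<open>\<lambda> \<noteq> 1\<close>, say \<open>\<lambda> = \<gamma>\<^sup>s\<close>.
  As \<open>M\<close> commutes with multiplication by \<open>\<lambda>\<close>, the difference \<open>F(\<lambda>\<zeta>) - \<lambda>F(\<zeta>)\<close> depends only on the coset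
  of \<open>\<zeta>\<close>. For all but \<open>2m\<close> of the \<open>\<zeta> = \<gamma>\<^sup>x\<close> it equals \<open>P(\<lambda>\<zeta>) - \<lambda>P(\<zeta>)\<close>, which is \<open>(1 - \<lambda>)\<xi>\<^sub>x\<close> plus a term that
  takes at most \<open>2\<^sup>n\<close> values: it depends only on whether the exponent \<open>x + s\<close> is reduced modulo \<open>T\<close>
  and on the carries of the corresponding base-\<open>p\<close> addition. Hence each coset accounts for
  at most \<open>2\<^sup>n\<close> values of \<open>x\<close>.
\<close>

section \<open>The prime field and linearised polynomials\<close>

lemma CHAR_eq_of_prime_power_CARD:
  assumes "prime p" and "CARD('a::finite_field) = p ^ n"
  shows "CHAR('a) = p"
proof -
  have "prime CHAR('a)"
    by (rule prime_CHAR_semidom) (simp add: finite_imp_CHAR_pos)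
  moreover have "CHAR('a) dvd p ^ n"
    using CHAR_dvd_CARD[where 'a = 'a] assms(2) by simp
  ultimately show ?thesis
    using assms(1) prime_dvd_power primes_dvd_imp_eq by blast
qed

text \<open>Any integer representative of a scalar acts alike, since reduction modulo
  \<open>CHAR('a)\<close> does not change its image in the field. This admits negative
  representatives such as differences of digits.\<close>

lemma Fp_scale_of_int: "Fp_scale (of_int c) x = of_int c * (x :: 'a::field_prime_char)"
proof -
  have "to_int_mod_ring (of_int c :: 'a ring_char mod_ring) = c mod int CHAR('a)"
    by (metis CARD_ring_char of_int_mod_ring.rep_eq of_int_of_int_mod_ring to_int_mod_ring.rep_eq)
  then show ?thesis
    by (simp add: Fp_scale_def)
qed

text \<open>Root counting: \<open>X ^ p - X\<close> has at most \<open>p\<close> roots, and by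
  Fermat the \<open>p\<close> distinct elements \<open>of_nat c\<close> with \<open>c < p\<close>
  are already roots.\<close>

lemma mem_prime_field_of_power_eq:
  fixes l :: "'a::finite_field"
  assumes l: "l ^ CHAR('a) = l"
  obtains c where "l = of_nat c"
proof -
  define p where "p = CHAR('a)"
  have p: "prime p"
    unfolding p_def by (rule prime_CHAR_semidom) (simp add: finite_imp_CHAR_pos)
  define f :: "'a poly" where "f = monom 1 p - monom 1 1"
  have "coeff f p = 1"
    using prime_gt_1_nat[OF p] by (simp add: f_def)
  then have "f \<noteq> 0" by auto
  have "degree f \<le> p"
    unfolding f_def using prime_gt_1_nat[OF p]
    by (intro degree_diff_le degree_monom_le) (auto intro: order.trans[OF degree_monom_le])
  then have "card {x. poly f x = 0} \<le> p"
    using card_poly_roots_bound[OF \<open>f \<noteq> 0\<close>] by linarith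
  moreover have "{x. poly f x = 0} = {x. x ^ p = x}"
    by (simp add: f_def poly_monom)
  moreover have "inj_on (of_nat :: nat \<Rightarrow> 'a) {..<p}"
    by (rule inj_onI) (auto simp: of_nat_eq_iff_cong_CHAR cong_def p_def)
  then have "card ((of_nat :: nat \<Rightarrow> 'a) ` {..<p}) = p"
    by (simp add: card_image)
  moreover have "(of_nat c :: 'a) ^ p = of_nat c" for c
  proof -
    have "[c ^ p = c] (mod p)"
    proof (cases "p dvd c")
      case True
      then show ?thesis
        using p by (simp add: cong_def prime_gt_0_nat dvd_power_le mod_eq_0_iff_dvd prime_dvd_power_iff)
    next
      case False
      then have "[c * c ^ (p - 1) = c * 1] (mod p)"
        using fermat_theorem[OF p] by (intro cong_scalar_left)
      moreover have "c ^ p = c * c ^ (p - 1)"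
        using prime_gt_0_nat[OF p] by (simp add: power_eq_if[of c p])
      ultimately show ?thesis by simp
    qed
    then have "(of_nat (c ^ p) :: 'a) = of_nat c"
      by (simp only: of_nat_eq_iff_cong_CHAR p_def)
    then show ?thesis by simp
  qed
  then have "(of_nat :: nat \<Rightarrow> 'a) ` {..<p} \<subseteq> {x. x ^ p = x}" by auto
  ultimately have "(of_nat :: nat \<Rightarrow> 'a) ` {..<p} = {x. x ^ p = x}"
    by (intro card_seteq) auto
  then show ?thesis
    using l that unfolding p_def by blast
qed

text \<open>An element fixed by the Frobenius map is fixed by each of its iterates, so it can be
  pulled out of every term of \<open>M\<close>.\<close>

lemma poly_linearised_scale:
  assumes M: "linearised_poly p n M" and l: "l ^ p = l"
  shows "poly M (l * z) = l * poly M z"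
proof -
  have "l ^ (p ^ j) = l" for j
    by (induction j) (simp_all add: power_mult l mult.commute)
  moreover obtain c where "M = (\<Sum>j<n. monom (c j) (p ^ j))"
    using M by (auto simp: linearised_poly_def)
  ultimately show ?thesis
    by (simp add: poly_sum poly_monom power_mult_distrib sum_distrib_left mult_ac)
qed

section \<open>Cosets of a subspace and their number\<close>

lemma coset_eq_iff:
  fixes U :: "'a::finite_field set"
  assumes "Fp.subspace U"
  shows "coset U y = coset U z \<longleftrightarrow> y - z \<in> U"
proof
  assume "coset U y = coset U z"
  then have "y \<in> coset U z"
    using Fp.subspace_0[OF assms] by (force simp: coset_def)
  then show "y - z \<in> U" by (auto simp: coset_def)
next
  assume d: "y - z \<in> U"
  have sub: "coset U y \<subseteq> coset U z" if "y - z \<in> U" for y z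
  proof
    fix w assume "w \<in> coset U y"
    then obtain u where "u \<in> U" "w = u + y" by (auto simp: coset_def)
    then have "u + (y - z) \<in> U" "w = (u + (y - z)) + z"
      using Fp.subspace_add[OF assms _ that] by auto
    then show "w \<in> coset U z" unfolding coset_def by blast
  qed
  have "z - y \<in> U"
    using Fp.subspace_neg[OF assms d] by simp
  then show "coset U y = coset U z"
    using sub d by blast
qed

text \<open>When a basis \<open>B\<close> of \<open>U\<close> is extended to a basis of the whole
  field, every coset has a representative in the span of the added vectors \<open>D\<close>.
  Coefficient vectors on \<open>D\<close> therefore map onto the cosets.\<close>

lemma card_cosets_le:
  fixes U :: "'a::finite_field set"
  assumes U: "Fp.subspace U"
  shows "card (range (coset U)) \<le> CHAR('a) ^ Fp_codim U"
proof -
  obtain B where B: "B \<subseteq> U" "Fp.independent B" "U \<subseteq> Fp.span B" "card B = Fp.dim U"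
    by (rule Fp.basis_exists)
  obtain C where C: "B \<subseteq> C" "Fp.independent C" "UNIV \<subseteq> Fp.span C"
    by (rule Fp.maximal_independent_subset_extend[OF subset_UNIV B(2)])
  define D where "D = C - B"
  have "card C = Fp.dim (UNIV :: 'a set)"
    using C by (intro Fp.basis_card_eq_dim) auto
  then have D: "card D = Fp_codim U"
    unfolding D_def Fp_codim_def using C(1) B(4) by (simp add: card_Diff_subset)
  define h where "h f = coset U (\<Sum>v\<in>D. Fp_scale (f v) v)" for f
  have "range (coset U) \<subseteq> h ` (D \<rightarrow>\<^sub>E UNIV)"
  proof
    fix V assume "V \<in> range (coset U)"
    then obtain z where z: "V = coset U z" by blast
    have "C = B \<union> D" using C(1) by (auto simp: D_def)
    then have "z \<in> Fp.span (B \<union> D)" using C(3) by auto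
    then obtain b d where zbd: "z = b + d" and b: "b \<in> Fp.span B" and d: "d \<in> Fp.span D"
      unfolding Fp.span_Un by blast
    have "b \<in> U"
      using b Fp.span_minimal[OF B(1) U] by blast
    obtain f where f: "d = (\<Sum>v\<in>D. Fp_scale (f v) v)"
      using d unfolding Fp.span_finite[OF finite[of D]] by blast
    have "V = coset U d"
      unfolding z using \<open>b \<in> U\<close> by (simp add: coset_eq_iff[OF U] zbd)
    \<comment> \<open>Restricting puts the coefficients into the finite set of extensional functions
      without changing the sum over \<open>D\<close>.\<close>
    also have "\<dots> = h (restrict f D)"
      by (simp add: h_def f)
    finally show "V \<in> h ` (D \<rightarrow>\<^sub>E UNIV)" by auto
  qed
  then have "card (range (coset U)) \<le> card (D \<rightarrow>\<^sub>E (UNIV :: 'a ring_char mod_ring set))"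
    by (rule surj_card_le[rotated]) (simp add: finite_PiE)
  also have "\<dots> = CHAR('a) ^ Fp_codim U"
    by (simp add: card_PiE D)
  finally show ?thesis .
qed

section \<open>Base-\<open>p\<close> digits and the map \<open>xi\<close>\<close>

lemma nat_eq_of_digits_eq:
  fixes x y p :: nat
  assumes "x < p ^ n" and "y < p ^ n"
    and "\<And>i. i < n \<Longrightarrow> x div p ^ i mod p = y div p ^ i mod p"
  shows "x = y"
  using assms
proof (induction n arbitrary: x y)
  case (Suc n)
  have "x div p = y div p"
  proof (rule Suc.IH)
    show "x div p < p ^ n" "y div p < p ^ n"
      using Suc.prems(1,2) by (simp_all add: less_mult_imp_div_less mult.commute)
    show "x div p div p ^ i mod p = y div p div p ^ i mod p" if "i < n" for i
      using Suc.prems(3)[of "Suc i"] that by (simp add: div_mult2_eq)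
  qed
  moreover have "x mod p = y mod p"
    using Suc.prems(3)[of 0] by simp
  ultimately show ?case by (metis div_mult_mod_eq)
qed simp

text \<open>Equal values give a vanishing combination of the basis with digit differences as
  coefficients. Independence makes these divisible by \<open>p\<close>, and digits are less than
  \<open>p\<close>.\<close>

lemma inj_on_xi:
  fixes \<beta> :: "nat \<Rightarrow> 'a::finite_field"
  assumes \<beta>: "ordered_Fp_basis n \<beta>" and p: "CHAR('a) = p"
  shows "inj_on (xi p n \<beta>) {..<p ^ n}"
proof (rule inj_onI)
  fix x y assume xy: "x \<in> {..<p ^ n}" "y \<in> {..<p ^ n}" "xi p n \<beta> x = xi p n \<beta> y"
  have inj: "inj_on \<beta> {1..n}" and ind: "Fp.independent (\<beta> ` {1..n})"
    using \<beta> by (auto simp: ordered_Fp_basis_def)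
  define e where "e i = int (x div p ^ (i - 1) mod p) - int (y div p ^ (i - 1) mod p)" for i
  \<comment> \<open>Independence speaks of coefficients indexed by vectors, so the differences are
    carried over from indices along the inverse of \<open>\<beta>\<close>.\<close>
  define u :: "'a \<Rightarrow> 'a ring_char mod_ring" where "u v = of_int (e (inv_into {1..n} \<beta> v))" for v
  have u: "u (\<beta> i) = of_int (e i)" if "i \<in> {1..n}" for i
    using that inj by (simp add: u_def)
  have "(\<Sum>v\<in>\<beta> ` {1..n}. Fp_scale (u v) v) = (\<Sum>i=1..n. of_int (e i) * \<beta> i)"
    using inj by (simp add: sum.reindex u Fp_scale_of_int)
  also have "\<dots> = xi p n \<beta> x - xi p n \<beta> y"
    by (simp add: xi_def e_def sum_subtractf algebra_simps)
  finally have sum0: "(\<Sum>v\<in>\<beta> ` {1..n}. Fp_scale (u v) v) = 0"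
    using xy by simp
  show "x = y"
  proof (rule nat_eq_of_digits_eq)
    fix i assume "i < n"
    then have i: "Suc i \<in> {1..n}" by auto
    have "u (\<beta> (Suc i)) = 0"
      using Fp.independentD[OF ind _ _ sum0] i by blast
    then have "(of_int (e (Suc i)) :: 'a ring_char mod_ring) = 0"
      using u[OF i] by simp
    then have "int p dvd e (Suc i)"
      by (simp only: of_int_eq_0_iff_char_dvd semiring_char_mod_ring CARD_ring_char p)
    then have "int (x div p ^ i mod p) mod int p = int (y div p ^ i mod p) mod int p"
      by (simp only: e_def mod_eq_dvd_iff diff_Suc_1)
    then show "x div p ^ i mod p = y div p ^ i mod p"
      by (simp flip: zmod_int)
  qed (use xy in auto)
qed

text \<open>The positions, counted from 0, that receive a carry when \<open>x\<close> and
  \<open>y\<close> are added in base \<open>p\<close>. Position 0 never does, and a carry out of the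
  top digit is invisible to \<open>xi\<close>, so there are at most \<open>2 ^ (n - 1)\<close>
  patterns.\<close>

definition carries :: "nat \<Rightarrow> nat \<Rightarrow> nat \<Rightarrow> nat \<Rightarrow> nat set" where
  "carries p n x y = {i \<in> {1..<n}. p ^ i \<le> x mod p ^ i + y mod p ^ i}"

lemma xi_add:
  fixes \<beta> :: "nat \<Rightarrow> 'a::field"
  assumes p: "CHAR('a) = p" and "p > 0"
  shows "xi p n \<beta> (x + y) = xi p n \<beta> x + xi p n \<beta> y + (\<Sum>i\<in>carries p n x y. \<beta> (Suc i))"
proof -
  \<comment> \<open>In characteristic \<open>p\<close> the digit may be replaced by the whole
    quotient \<open>z div p ^ i\<close>, which is additive up to the carry.\<close>
  have xi: "xi p n \<beta> z = (\<Sum>i<n. of_nat (z div p ^ i) * \<beta> (Suc i))" for z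
    unfolding xi_def
    by (rule sum.reindex_bij_witness[of _ Suc "\<lambda>i. i - 1"]) (auto simp flip: p)
  have div: "(x + y) div p ^ i = x div p ^ i + y div p ^ i + of_bool (i \<in> carries p n x y)"
    if "i < n" for i
  proof -
    let ?q = "p ^ i"
    have "?q > 0" using \<open>p > 0\<close> by simp
    then have "x mod ?q < ?q" "y mod ?q < ?q" by auto
    then have "(x mod ?q + y mod ?q) div ?q = of_bool (?q \<le> x mod ?q + y mod ?q)"
      by (auto simp: div_nat_eqI)
    moreover have "i \<in> carries p n x y \<longleftrightarrow> ?q \<le> x mod ?q + y mod ?q"
      using that by (cases "i = 0") (auto simp: carries_def)
    ultimately show ?thesis
      by (simp add: div_add1_eq[of x y])
  qed
  have "xi p n \<beta> (x + y) = (\<Sum>i<n. (of_nat (x div p ^ i) + of_nat (y div p ^ i)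
      + of_bool (i \<in> carries p n x y)) * \<beta> (Suc i))"
    unfolding xi by (intro sum.cong) (simp_all add: div)
  also have "\<dots> = xi p n \<beta> x + xi p n \<beta> y
      + (\<Sum>i<n. of_bool (i \<in> carries p n x y) * \<beta> (Suc i))"
    by (simp add: xi algebra_simps sum.distrib)
  also have "(\<Sum>i<n. of_bool (i \<in> carries p n x y) * \<beta> (Suc i))
      = (\<Sum>i\<in>carries p n x y. \<beta> (Suc i))"
    by (rule sum.mono_neutral_cong_right) (auto simp: carries_def)
  finally show ?thesis .
qed

section \<open>Powers up to the multiplicative order\<close>

lemma mult_order_props:
  fixes g :: "'a::finite_field"
  assumes "g \<noteq> 0"
  shows "mult_order g > 0" and "g ^ mult_order g = 1"
    and "inj_on (\<lambda>x. g ^ x) {..<mult_order g}"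
proof -
  have "\<not> inj (\<lambda>x::nat. g ^ x)"
    using finite_imageD[of "\<lambda>x::nat. g ^ x" UNIV] by auto
  then obtain x y :: nat where xy: "x < y" "g ^ x = g ^ y"
    unfolding inj_def by (metis linorder_neqE_nat)
  have diff: "g ^ (y - x) = 1" if "x < y" "g ^ x = g ^ y" for x y
    using that assms by (simp add: power_diff)
  have "0 < y - x \<and> g ^ (y - x) = 1"
    using xy diff by simp
  then show "mult_order g > 0" "g ^ mult_order g = 1"
    using LeastI[of "\<lambda>t. 0 < t \<and> g ^ t = 1" "y - x"] by (auto simp: mult_order_def)
  show "inj_on (\<lambda>x. g ^ x) {..<mult_order g}"
  proof (rule linorder_inj_onI)
    fix x y assume "x < y" "x \<in> {..<mult_order g}" "y \<in> {..<mult_order g}"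
    then show "g ^ x \<noteq> g ^ y"
      using diff[of x y] not_less_Least[of "y - x" "\<lambda>t. 0 < t \<and> g ^ t = 1"]
      by (auto simp: mult_order_def)
  qed auto
qed

section \<open>Counting exponents by coset, wrap-around and carries\<close>

theorem theorem4p9:
  fixes p n T m k :: nat
    and \<gamma> :: "'a::finite_field"
    and \<beta> :: "nat \<Rightarrow> 'a"
    and P F :: "'a \<Rightarrow> 'a"
    and U :: "'a set"
    and M :: "'a poly"
    and a :: "'a set \<Rightarrow> 'a"
  assumes "prime p" and "n \<ge> 1" and "CARD('a) = p ^ n"
    and "\<gamma> \<noteq> 0" and "mult_order \<gamma> = T"
    and "ordered_Fp_basis n \<beta>"
    and "\<And>x. x < T \<Longrightarrow> P (\<gamma> ^ x) = xi p n \<beta> x"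
    and "m \<le> T"
    and "card {\<zeta> \<in> cyclic_subgroup \<gamma>. F \<zeta> \<noteq> P \<zeta>} \<le> m"
    and "Fp.subspace U" and "Fp_codim U = k"
    and "linearised_poly p n M"
    and "\<And>\<zeta>. F \<zeta> = poly M \<zeta> + a (coset U \<zeta>)"
    and "gcd T (p - 1) > 1"
  shows "real (p ^ k) \<ge> (real T - 2 * real m) / 2 ^ n"
proof -
  note P = assms(7) and U = assms(10) and F = assms(13)
  have CHAR: "CHAR('a) = p"
    using CHAR_eq_of_prime_power_CARD assms(1,3) .
  have "p > 0" using assms(1) by (rule prime_gt_0_nat)
  have T: "T > 0" "\<gamma> ^ T = 1" "inj_on (\<lambda>x. \<gamma> ^ x) {..<T}"
    using mult_order_props[OF assms(4)] assms(5) by auto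

  \<comment> \<open>With this exponent \<open>\<gamma> ^ s\<close> has order
    \<open>gcd T (p - 1)\<close>. The order divides \<open>p - 1\<close>, which puts
    \<open>l\<close> into the prime field, and exceeds 1, which gives
    \<open>l \<noteq> 1\<close>.\<close>
  define s where "s = T div gcd T (p - 1)"
  define l where "l = \<gamma> ^ s"
  have s: "0 < s" "s < T"
    using T(1) assms(14) by (auto simp: s_def div_greater_zero_iff gcd_le1_nat)
  have l1: "l \<noteq> 1"
    using inj_onD[OF T(3), of s 0] s by (auto simp: l_def)
  have "T dvd s * (p - 1)"
    unfolding s_def by (metis dvd_div_mult dvd_triv_left gcd_dvd1 gcd_dvd2 dvd_div_mult_self mult_dvd_mono mult.commute dvd_refl)
  then have "l ^ (p - 1) = 1"
    by (metis T(2) dvdE l_def power_mult power_one)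
  then have lp: "l ^ p = l"
    using \<open>p > 0\<close> by (metis power_eq_if mult.right_neutral neq0_conv)
  obtain c where c: "l = of_nat c"
    using mem_prime_field_of_power_eq[of l] lp CHAR by auto

  have coset_l: "coset U (l * y) = coset U (l * z)" if "coset U y = coset U z" for y z
  proof -
    have "Fp_scale (of_int (int c)) (y - z) \<in> U"
      using that U coset_eq_iff Fp.subspace_scale by blast
    then show ?thesis
      by (simp only: Fp_scale_of_int coset_eq_iff[OF U]) (simp add: c right_diff_distrib)
  qed
  have F_diff: "F (l * z) - l * F z = a (coset U (l * z)) - l * a (coset U z)" for z
    by (simp add: F poly_linearised_scale[OF assms(12) lp] algebra_simps)

  define bad where "bad = {\<zeta> \<in> cyclic_subgroup \<gamma>. F \<zeta> \<noteq> P \<zeta>}"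
  define X where "X = {x. x < T \<and> \<gamma> ^ x \<notin> bad \<and> l * \<gamma> ^ x \<notin> bad}"
  have pow_mem: "\<gamma> ^ x \<in> cyclic_subgroup \<gamma>" for x
    unfolding cyclic_subgroup_def by (rule range_eqI[of _ _ "int x"]) simp
  have l_pow: "l * \<gamma> ^ x = \<gamma> ^ (x + s)" for x
    by (simp add: l_def power_add)
  have good: "F (\<gamma> ^ x) = P (\<gamma> ^ x)" if "\<gamma> ^ x \<notin> bad" for x
    using that pow_mem by (auto simp: bad_def)
  have "l \<noteq> 0" using assms(4) by (simp add: l_def)

  \<comment> \<open>Each of the two conditions defining \<open>X\<close> excludes at most
    \<open>m\<close> exponents, because \<open>\<gamma> ^ x\<close> and
    \<open>l * \<gamma> ^ x\<close> are both injective in \<open>x < T\<close>.\<close>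
  have "T \<le> card X + 2 * m"
  proof -
    define B1 where "B1 = {x. x < T \<and> \<gamma> ^ x \<in> bad}"
    define B2 where "B2 = {x. x < T \<and> l * \<gamma> ^ x \<in> bad}"
    have "card B1 \<le> card bad"
      by (rule card_inj_on_le[of "\<lambda>x. \<gamma> ^ x"]) (auto simp: B1_def intro: inj_on_subset[OF T(3)])
    moreover have "inj_on (\<lambda>x. l * \<gamma> ^ x) {..<T}"
      using T(3) \<open>l \<noteq> 0\<close> by (auto simp: inj_on_def)
    then have "card B2 \<le> card bad"
      by (intro card_inj_on_le[of "\<lambda>x. l * \<gamma> ^ x"]) (auto simp: B2_def intro: inj_on_subset)
    moreover have "{..<T} = X \<union> (B1 \<union> B2)"
      by (auto simp: X_def B1_def B2_def)
    then have "T = card (X \<union> (B1 \<union> B2))"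
      by (metis card_lessThan)
    then have "T \<le> card X + (card B1 + card B2)"
      using card_Un_le[of X "B1 \<union> B2"] card_Un_le[of B1 B2] by linarith
    ultimately show ?thesis
      using assms(9) by (fold bad_def) linarith
  qed

  \<comment> \<open>If \<open>x + s\<close> wraps around, the sum recorded is
    \<open>(x + s - T) + (T - s) = x\<close>, so that subtracting \<open>T - s\<close> from
    \<open>x\<close> is again described by carries rather than borrows.\<close>
  define data where "data x = (coset U (\<gamma> ^ x), x + s < T,
    if x + s < T then carries p n x s else carries p n (x + s - T) (T - s))" for x
  \<comment> \<open>The difference between \<open>P (l * \<gamma> ^ x)\<close> and
    \<open>xi p n \<beta> x\<close>, as a function of the last two components of
    \<open>data x\<close> alone.\<close>
  define t where "t b C = (if b then xi p n \<beta> s + (\<Sum>i\<in>C. \<beta> (Suc i))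
    else - xi p n \<beta> (T - s) - (\<Sum>i\<in>C. \<beta> (Suc i)))" for b C
  have P_shift: "P (l * \<gamma> ^ x) = xi p n \<beta> x + t (fst (snd (data x))) (snd (snd (data x)))"
    if "x < T" for x
  proof (cases "x + s < T")
    case True
    then show ?thesis
      by (simp add: l_pow P data_def t_def xi_add[OF CHAR \<open>p > 0\<close>])
  next
    case False
    define y where "y = x + s - T"
    have "y < T" "x = y + (T - s)" "x + s = y + T"
      using False that s by (auto simp: y_def)
    have "l * \<gamma> ^ x = \<gamma> ^ (y + T)"
      by (simp only: l_pow \<open>x + s = y + T\<close>)
    then have "l * \<gamma> ^ x = \<gamma> ^ y"
      by (simp add: power_add T(2))
    then have "P (l * \<gamma> ^ x) = xi p n \<beta> y"
      using P \<open>y < T\<close> by simp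
    moreover have "xi p n \<beta> x = xi p n \<beta> y + xi p n \<beta> (T - s)
        + (\<Sum>i\<in>carries p n y (T - s). \<beta> (Suc i))"
      using xi_add[OF CHAR \<open>p > 0\<close>, of n \<beta> y "T - s"] \<open>x = y + (T - s)\<close> by simp
    ultimately show ?thesis
      using False by (simp add: data_def t_def flip: y_def)
  qed
  have F_diff_X: "F (l * \<gamma> ^ x) - l * F (\<gamma> ^ x)
      = (1 - l) * xi p n \<beta> x + t (fst (snd (data x))) (snd (snd (data x)))" if "x \<in> X" for x
  proof -
    have "F (l * \<gamma> ^ x) = P (l * \<gamma> ^ x)" "F (\<gamma> ^ x) = xi p n \<beta> x"
      using that good good[of "x + s"] P by (auto simp: X_def l_pow)
    then show ?thesis
      using P_shift[of x] that by (simp add: X_def algebra_simps)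
  qed
  \<comment> \<open>This places all exponents below \<open>T\<close> in the range where
    \<open>xi\<close> is injective.\<close>
  have "T \<le> p ^ n"
    using card_inj_on_le[OF T(3), of UNIV] assms(3) by simp
  have "inj_on data X"
  proof (rule inj_onI)
    fix x y assume xy: "x \<in> X" "y \<in> X" "data x = data y"
    then have "coset U (\<gamma> ^ x) = coset U (\<gamma> ^ y)"
      by (simp add: data_def)
    \<comment> \<open>The coset fixes the left side of \<open>F_diff_X\<close> and the other
      components fix the summand \<open>t\<close>. What remains is
      \<open>(1 - l) * xi p n \<beta> x\<close>, whose factor \<open>1 - l\<close> cancels.\<close>
    then have "F (l * \<gamma> ^ x) - l * F (\<gamma> ^ x) = F (l * \<gamma> ^ y) - l * F (\<gamma> ^ y)"
      unfolding F_diff using coset_l by metis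
    then have "xi p n \<beta> x = xi p n \<beta> y"
      using F_diff_X xy l1 by simp
    then show "x = y"
      using inj_onD[OF inj_on_xi[OF assms(6) CHAR]] xy(1,2) \<open>T \<le> p ^ n\<close> by (auto simp: X_def)
  qed
  moreover have "data ` X \<subseteq> range (coset U) \<times> (UNIV :: bool set) \<times> Pow {1..<n}"
    by (auto simp: data_def carries_def split: if_splits)
  ultimately have "card X \<le> card (range (coset U) \<times> (UNIV :: bool set) \<times> Pow {1..<n})"
    by (intro card_inj_on_le[of data]) auto
  \<comment> \<open>The wrap-around flag contributes 2 and the carry sets
    \<open>2 ^ (n - 1)\<close>; \<open>n \<ge> 1\<close> makes the product
    \<open>2 ^ n\<close>.\<close>
  also have "\<dots> = card (range (coset U)) * 2 ^ n"
    using assms(2) by (cases n) (simp_all add: card_cartesian_product card_Pow)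
  also have "\<dots> \<le> p ^ k * 2 ^ n"
    using card_cosets_le[OF U] CHAR assms(11) by simp
  finally have "T \<le> p ^ k * 2 ^ n + 2 * m"
    using \<open>T \<le> card X + 2 * m\<close> by linarith
  then have "real T \<le> real (p ^ k * 2 ^ n + 2 * m)"
    by (rule of_nat_mono)
  then show ?thesis
    by (simp add: field_simps)
qed

end
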